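(* Let $r\in\mathbb{N}$ and let $\chi:\mathbb{R}^2\to\mathbb{R}$ be a kernel as in the context, satisfying in addition the following moment condition: for every $(u,v)\in\mathbb{R}^2$ one has $m^{\eta}_{(p_1,p_2)}(\chi,u,v)=0$ whenever $\eta=p_1+p_2\in\{1,2,\dots,r-1\}$, and $m^{\eta}_{(p_1,p_2)}(\chi,u,v)=c$ whenever $\eta=p_1+p_2=r$, where $c$ is a constant. Then for every $w>0$ the operator $S_w$ maps algebraic polynomials (in two variables) of degree at most $r-1$ into algebraic polynomials of the same degree.
   Context: For $p=(p_1,p_2)\in\mathbb{N}_0^2$ with $p_1+p_2=\eta$, the algebraic and absolute moments of $\chi$ are $$m^{\eta}_{(p_1,p_2)}(\chi,u,v)=\sum_{k\in\mathbb{Z}}\sum_{j\in\mathbb{Z}}\chi(u-k,v-j)(u-k)^{p_1}(v-j)^{p_2},$$ $$M^{\eta}_{(p_1,p_2)}(\chi)=\sup_{(u,v)\in\mathbb{R}^2}\sum_{k\in\mathbb{Z}}\sum_{j\in\mathbb{Z}}|\chi(u-k,v-j)|\,|u-k|^{p_1}|v-j|^{p_2},\qquad M_\eta(\chi)=\max_{p_1+p_2=\eta}M^{\eta}_{(p_1,p_2)}(\chi).$$ The moment condition includes that the series defining the moments it mentions converge. Standing assumptions on the kernel: $\chi\in C^0(\mathbb{R}^2)$ (continuous and bounded); (K1) $\chi$ is integrable and bounded at the origin; (K2) $\sum_{k\in\mathbb{Z}}\sum_{j\in\mathbb{Z}}\chi(u-k,v-j)=1$ for every $(u,v)\in\mathbb{R}^2$;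 (K3) $M_\eta(\chi)<+\infty$ for some $\eta=p_1+p_2$ with $p_1,p_2$ positive integers. For $w>0$ the bivariate Kantorovich type sampling series is $$(S_w f)(x,y)=\sum_{k\in\mathbb{Z}}\sum_{j\in\mathbb{Z}}\chi(wx-k,wy-j)\Bigg[w^2\int_{\frac kw}^{\frac{k+1}w}\int_{\frac jw}^{\frac{j+1}w}f(u,v)\,dv\,du\Bigg],$$ where $u$ ranges over $(\frac kw,\frac{k+1}w)$ and $v$ over $(\frac jw,\frac{j+1}w)$. *)

theory Defs
  imports "HOL-Analysis.Analysis" "HOL-Computational_Algebra.Polynomial"
begin

text \<open>
  The double series \<open>\<Sum>k. \<Sum>j. a k j\<close> are iterated series over the integers, and each of the two
  summations is the unordered summation of the library. Since \<^const>\<open>infsum\<close> is \<open>0\<close> on families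
  that are not summable, convergence is stated separately.
\<close>

definition double_summable :: "(int \<Rightarrow> int \<Rightarrow> real) \<Rightarrow> bool" where
  "double_summable a \<longleftrightarrow>
     (\<forall>k. a k summable_on UNIV) \<and> (\<lambda>k. \<Sum>\<^sub>\<infinity>j. a k j) summable_on UNIV"

definition double_sum :: "(int \<Rightarrow> int \<Rightarrow> real) \<Rightarrow> real" where
  "double_sum a = (\<Sum>\<^sub>\<infinity>k. \<Sum>\<^sub>\<infinity>j. a k j)"

definition moment_term ::
    "(real \<times> real \<Rightarrow> real) \<Rightarrow> nat \<Rightarrow> nat \<Rightarrow> real \<Rightarrow> real \<Rightarrow> int \<Rightarrow> int \<Rightarrow> real" where
  "moment_term chi p1 p2 u v k j =
     chi (u - of_int k, v - of_int j) * (u - of_int k) ^ p1 * (v - of_int j) ^ p2"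

text \<open>The order \<open>\<eta>\<close> of a moment is \<open>p1 + p2\<close> and is not a separate argument.\<close>

definition moment ::
    "(real \<times> real \<Rightarrow> real) \<Rightarrow> nat \<Rightarrow> nat \<Rightarrow> real \<Rightarrow> real \<Rightarrow> real" where
  "moment chi p1 p2 u v = double_sum (moment_term chi p1 p2 u v)"

definition abs_moment :: "(real \<times> real \<Rightarrow> real) \<Rightarrow> nat \<Rightarrow> nat \<Rightarrow> ennreal" where
  "abs_moment chi p1 p2 =
     (SUP (u, v) \<in> UNIV. \<Sum>\<^sub>\<infinity>k. \<Sum>\<^sub>\<infinity>j.
        ennreal (\<bar>chi (u - of_int k, v - of_int j)\<bar>
                 * \<bar>u - of_int k\<bar> ^ p1 * \<bar>v - of_int j\<bar> ^ p2))"

definition max_abs_moment :: "(real \<times> real \<Rightarrow> real) \<Rightarrow> nat \<Rightarrow> ennreal" where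
  "max_abs_moment chi \<eta> = (MAX (p1, p2) \<in> {(p1, p2). p1 + p2 = \<eta>}. abs_moment chi p1 p2)"

definition sampling_kernel :: "(real \<times> real \<Rightarrow> real) \<Rightarrow> bool" where
  "sampling_kernel chi \<longleftrightarrow>
     continuous_on UNIV chi \<and> bounded (range chi) \<and>
     integrable lborel chi \<and> (\<exists>\<delta>>0. bounded (chi ` ball 0 \<delta>)) \<and>
     (\<forall>u v. double_summable (\<lambda>k j. chi (u - of_int k, v - of_int j)) \<and>
            double_sum (\<lambda>k j. chi (u - of_int k, v - of_int j)) = 1) \<and>
     (\<exists>p1 p2. 0 < p1 \<and> 0 < p2 \<and> max_abs_moment chi (p1 + p2) < \<infinity>)"

definition moment_condition :: "nat \<Rightarrow> real \<Rightarrow> (real \<times> real \<Rightarrow> real) \<Rightarrow> bool" where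
  "moment_condition r c chi \<longleftrightarrow>
     (\<forall>u v p1 p2.
        (p1 + p2 \<in> {1..r} \<longrightarrow> double_summable (moment_term chi p1 p2 u v)) \<and>
        (p1 + p2 \<in> {1..<r} \<longrightarrow> moment chi p1 p2 u v = 0) \<and>
        (p1 + p2 = r \<longrightarrow> moment chi p1 p2 u v = c))"

definition kantorovich_term ::
    "(real \<times> real \<Rightarrow> real) \<Rightarrow> real \<Rightarrow> (real \<times> real \<Rightarrow> real) \<Rightarrow> real \<Rightarrow> real
      \<Rightarrow> int \<Rightarrow> int \<Rightarrow> real" where
  "kantorovich_term chi w f x y k j =
     chi (w * x - of_int k, w * y - of_int j) *
     (w\<^sup>2 * (LBINT u:{of_int k / w..(of_int k + 1) / w}.
             (LBINT v:{of_int j / w..(of_int j + 1) / w}. f (u, v))))"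

definition kantorovich ::
    "(real \<times> real \<Rightarrow> real) \<Rightarrow> real \<Rightarrow> (real \<times> real \<Rightarrow> real) \<Rightarrow> real \<times> real \<Rightarrow> real" where
  "kantorovich chi w f = (\<lambda>(x, y). double_sum (kantorovich_term chi w f x y))"

text \<open>
  A polynomial in two variables is an element of \<open>\<real>[Y][X]\<close>: the coefficient of \<open>X\<^sup>i Y\<^sup>j\<close> in
  \<open>P\<close> is \<open>coeff (coeff P i) j\<close>.
\<close>

definition poly2 :: "real poly poly \<Rightarrow> real \<times> real \<Rightarrow> real" where
  "poly2 P = (\<lambda>(x, y). poly (poly P [:x:]) y)"

lemma poly2_altdef:
  "poly2 P (x, y) = (\<Sum>i\<le>degree P. \<Sum>j\<le>degree (coeff P i). coeff (coeff P i) j * x ^ i * y ^ j)"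
  by (simp add: poly2_def poly_altdef[of P] poly_sum poly_altdef[of "coeff P _"]
      sum_distrib_left sum_distrib_right mult_ac)

lemma finite_support2: "finite {(i, j). coeff (coeff P i) j \<noteq> (0::real)}"
proof (rule finite_subset)
  show "{(i, j). coeff (coeff P i) j \<noteq> 0} \<subseteq> (SIGMA i:{..degree P}. {..degree (coeff P i)})"
    by (auto intro: le_degree)
qed auto

text \<open>As for \<^const>\<open>degree\<close>, the total degree of the zero polynomial is \<open>0\<close>.\<close>

definition total_degree :: "real poly poly \<Rightarrow> nat" where
  "total_degree P = Max (insert 0 {i + j |i j. coeff (coeff P i) j \<noteq> 0})"

end

theory Submission
  imports Defs
begin

text \<open>
  Averaging \<open>t\<^sup>n\<close> over an interval \<open>[x, x + h]\<close> yields a monic polynomial \<open>M\<^sub>n\<close> of degree \<open>n\<close> in \<open>x\<close>.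
  The weights in the Kantorovich series of a polynomial
  \<open>P = \<Sum> p\<^sub>i\<^sub>j X\<^sup>i Y\<^sup>j\<close> are averages over squares of side \<open>h = 1/w\<close>; hence they are the values
  \<open>Q(k/w, j/w)\<close> at the nodes of one polynomial \<open>Q = \<Sum> p\<^sub>i\<^sub>j M\<^sub>i(X) M\<^sub>j(Y)\<close>
  (lemma \<open>kantorovich_term_poly2\<close>).

  The Kantorovich series of \<open>P\<close> is therefore the ordinary sampling series
  \<open>\<Sum> \<chi>(wx - k, wy - j) Q(k/w, j/w)\<close> of \<open>Q\<close>. Expanding \<open>Q\<close> about \<open>(x, y)\<close> turns it into a finite
  combination of moments of \<open>\<chi>\<close> of order at most \<open>r - 1\<close>. All of these vanish except the one of
  order \<open>0\<close>, which is \<open>1\<close> and whose coefficient is \<open>Q(x, y)\<close>. The sampling series thus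
  reproduces \<open>Q\<close> (lemma \<open>sampling_series_reproduces_polynomials\<close>), so that \<open>S\<^sub>w P = Q\<close>.

  Because the \<open>M\<^sub>n\<close> are monic of degree \<open>n\<close>, the polynomials \<open>P\<close> and \<open>Q\<close> have the same homogeneous
  part of top degree, which gives the equality of total degrees and \<open>Q = 0 \<longleftrightarrow> P = 0\<close>
  (lemmas \<open>total_degree_cell_mean\<close> and \<open>cell_mean_eq_0_iff\<close>).
\<close>

section \<open>Iterated double series\<close>

text \<open>
  Carrying the row sums as a witness reduces linearity of convergent double series to two
  applications of linearity of \<^const>\<open>has_sum\<close>.
\<close>

definition has_double_sum :: "(int \<Rightarrow> int \<Rightarrow> real) \<Rightarrow> real \<Rightarrow> bool" where
  "has_double_sum a s \<longleftrightarrow> (\<exists>b. (\<forall>k. (a k has_sum b k) UNIV) \<and> (b has_sum s) UNIV)"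

lemma has_double_sum_iff: "has_double_sum a s \<longleftrightarrow> double_summable a \<and> double_sum a = s"
proof
  assume "has_double_sum a s"
  then obtain b where b: "\<And>k. (a k has_sum b k) UNIV" and s: "(b has_sum s) UNIV"
    by (auto simp: has_double_sum_def)
  have "infsum (a k) UNIV = b k" for k
    using b by (rule infsumI)
  with b s show "double_summable a \<and> double_sum a = s"
    by (auto simp: double_summable_def double_sum_def has_sum_iff)
next
  assume "double_summable a \<and> double_sum a = s"
  then show "has_double_sum a s"
    unfolding has_double_sum_def double_summable_def double_sum_def
    by (intro exI[of _ "\<lambda>k. infsum (a k) UNIV"]) (auto simp: has_sum_iff)
qed

lemma has_double_sum_cmult:
  assumes "has_double_sum a s"
  shows "has_double_sum (\<lambda>k j. c * a k j) (c * s)"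
proof -
  obtain b where "\<And>k. (a k has_sum b k) UNIV" "(b has_sum s) UNIV"
    using assms by (auto simp: has_double_sum_def)
  then show ?thesis
    unfolding has_double_sum_def
    by (intro exI[of _ "\<lambda>k. c * b k"]) (auto intro: has_sum_cmult_right)
qed

lemma has_double_sum_add:
  assumes "has_double_sum a s" "has_double_sum a' s'"
  shows "has_double_sum (\<lambda>k j. a k j + a' k j) (s + s')"
proof -
  obtain b b' where "\<And>k. (a k has_sum b k) UNIV" "(b has_sum s) UNIV"
    "\<And>k. (a' k has_sum b' k) UNIV" "(b' has_sum s') UNIV"
    using assms by (auto simp: has_double_sum_def)
  then show ?thesis
    unfolding has_double_sum_def
    by (intro exI[of _ "\<lambda>k. b k + b' k"]) (auto intro: has_sum_add)
qed

lemma has_double_sum_sum: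
  assumes "\<And>i. i \<in> I \<Longrightarrow> has_double_sum (a i) (s i)"
  shows "has_double_sum (\<lambda>k j. \<Sum>i\<in>I. a i k j) (\<Sum>i\<in>I. s i)"
proof -
  have zero: "has_double_sum (\<lambda>_ _. 0) 0"
    unfolding has_double_sum_def by (intro exI[of _ "\<lambda>_. 0"]) simp
  show ?thesis
    using assms
    by (induction I rule: infinite_finite_induct) (simp_all add: zero has_double_sum_add)
qed

section \<open>Means of monomials over intervals\<close>

text \<open>
  The mean of \<open>t\<^sup>n\<close> over \<open>[x, x + h]\<close> as a polynomial in \<open>x\<close>, namely
  \<open>((x + h)\<^sup>n\<^sup>+\<^sup>1 - x\<^sup>n\<^sup>+\<^sup>1) / ((n + 1) h)\<close>.
\<close>

definition mean_monomial :: "real \<Rightarrow> nat \<Rightarrow> real poly" where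
  "mean_monomial h n =
     smult (1 / (real (Suc n) * h)) ([:h, 1:] ^ Suc n - monom 1 (Suc n))"

lemma coeff_mean_monomial_top:
  assumes "h \<noteq> 0"
  shows "coeff (mean_monomial h n) n = 1"
proof -
  have "coeff ([:h, 1:] ^ Suc n) n = real (Suc n) * h"
    by (subst coeff_linear_poly_power) (simp_all del: power_Suc)
  with assms show ?thesis
    by (simp add: mean_monomial_def del: power_Suc of_nat_Suc)
qed

lemma coeff_mean_monomial_eq_0:
  assumes "n < m"
  shows "coeff (mean_monomial h n) m = 0"
proof (cases "m = Suc n")
  case True
  then show ?thesis
    by (simp add: mean_monomial_def coeff_linear_power del: power_Suc)
next
  case False
  with assms have "degree ([:h, 1:] ^ Suc n) < m"
    by (simp add: degree_linear_power del: power_Suc)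
  with False show ?thesis
    by (simp add: mean_monomial_def coeff_eq_0 del: power_Suc)
qed

lemma degree_mean_monomial_le: "degree (mean_monomial h n) \<le> n"
  by (rule degree_le) (simp add: coeff_mean_monomial_eq_0)

lemma set_integral_power_eq_mean_monomial:
  assumes "h > 0"
  shows "(LBINT t:{x..x + h}. t ^ n) = h * poly (mean_monomial h n) x"
proof -
  have "(LBINT t:{x..x + h}. t ^ n) = ((x + h) ^ Suc n - x ^ Suc n) / Suc n"
    using integral_power[of x "x + h" n] assms
    by (simp add: set_lebesgue_integral_def mult.commute)
  also have "\<dots> = h * poly (mean_monomial h n) x"
    using assms
    by (simp add: mean_monomial_def poly_monom add.commute del: power_Suc of_nat_Suc)
  finally show ?thesis .
qed

lemma set_integral_finite_combination:
  fixes f :: "'i \<Rightarrow> real \<Rightarrow> real"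
  assumes "\<And>i. i \<in> I \<Longrightarrow> continuous_on {a..b} (f i)"
  shows "(LBINT t:{a..b}. (\<Sum>i\<in>I. c i * f i t)) = (\<Sum>i\<in>I. c i * (LBINT t:{a..b}. f i t))"
proof -
  have int: "integrable lborel (\<lambda>t. c i * (indicator {a..b} t * f i t))" if "i \<in> I" for i
    using borel_integrable_atLeastAtMost'[OF assms[OF that]]
    by (intro integrable_mult_right) (simp add: set_integrable_def)
  have "(LBINT t:{a..b}. (\<Sum>i\<in>I. c i * f i t)) =
      (LBINT t. (\<Sum>i\<in>I. c i * (indicator {a..b} t * f i t)))"
    by (simp add: set_lebesgue_integral_def sum_distrib_left mult.left_commute)
  also have "\<dots> = (\<Sum>i\<in>I. LBINT t. c i * (indicator {a..b} t * f i t))"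
    using int by (rule Bochner_Integration.integral_sum)
  finally show ?thesis
    by (simp add: set_lebesgue_integral_def)
qed

section \<open>Polynomials in two variables\<close>

definition support2 :: "real poly poly \<Rightarrow> (nat \<times> nat) set" where
  "support2 P = {(i, j). coeff (coeff P i) j \<noteq> 0}"

lemma finite_set_support2 [simp]: "finite (support2 P)"
  unfolding support2_def by (rule finite_support2)

lemma support2_eq_empty_iff: "support2 P = {} \<longleftrightarrow> P = 0"
  by (auto simp: support2_def poly_eq_iff)

lemma total_degree_eq_Max: "total_degree P = Max (insert 0 ((\<lambda>(i, j). i + j) ` support2 P))"
proof -
  have "{i + j |i j. coeff (coeff P i) j \<noteq> 0} = (\<lambda>(i, j). i + j) ` support2 P"
    by (force simp: support2_def)
  then show ?thesis
    by (simp add: total_degree_def)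
qed

lemma total_degree_ge:
  assumes "(i, j) \<in> support2 P"
  shows "i + j \<le> total_degree P"
  unfolding total_degree_eq_Max by (rule Max_ge) (use assms in force)+

lemma total_degree_le_iff:
  "total_degree P \<le> n \<longleftrightarrow> (\<forall>(i, j) \<in> support2 P. i + j \<le> n)"
  unfolding total_degree_eq_Max by (auto simp: Max_le_iff)

lemma total_degree_attained:
  assumes "P \<noteq> 0"
  obtains i j where "(i, j) \<in> support2 P" "i + j = total_degree P"
proof -
  have ne: "support2 P \<noteq> {}"
    using assms by (simp add: support2_eq_empty_iff)
  then have "total_degree P = Max ((\<lambda>(i, j). i + j) ` support2 P)"
    unfolding total_degree_eq_Max by (subst Max_insert) auto
  also have "\<dots> \<in> (\<lambda>(i, j). i + j) ` support2 P"
    by (rule Max_in) (use ne in auto)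
  finally show ?thesis
    using that by auto
qed

lemma poly2_support:
  "poly2 P (x, y) = (\<Sum>(i, j)\<in>support2 P. coeff (coeff P i) j * x ^ i * y ^ j)"
proof -
  have "poly2 P (x, y) = (\<Sum>(i, j)\<in>(SIGMA i:{..degree P}. {..degree (coeff P i)}).
      coeff (coeff P i) j * x ^ i * y ^ j)"
    unfolding poly2_altdef by (rule sum.Sigma) auto
  also have "\<dots> = (\<Sum>(i, j)\<in>support2 P. coeff (coeff P i) j * x ^ i * y ^ j)"
    by (rule sum.mono_neutral_right) (auto simp: support2_def intro: le_degree)
  finally show ?thesis .
qed

text \<open>The product \<open>p(X) q(Y)\<close>.\<close>

definition tensor :: "real poly \<Rightarrow> real poly \<Rightarrow> real poly poly" where
  "tensor p q = map_poly (\<lambda>a. smult a q) p"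

lemma coeff_tensor: "coeff (coeff (tensor p q) i) j = coeff p i * coeff q j"
  by (simp add: tensor_def coeff_map_poly)

lemma tensor_pCons: "tensor (pCons a p) q = pCons (smult a q) (tensor p q)"
  by (rule poly_eqI) (simp add: tensor_def coeff_map_poly coeff_pCons split: nat.split)

lemma poly2_tensor: "poly2 (tensor p q) (x, y) = poly p x * poly q y"
proof (induction p)
  case 0
  then show ?case by (simp add: poly2_def tensor_def)
next
  case (pCons a p)
  then show ?case by (simp add: poly2_def tensor_pCons algebra_simps)
qed

text \<open>
  For \<open>h > 0\<close>, its value at \<open>(x, y)\<close> is the mean of \<open>P\<close> over \<open>[x, x + h] \<times> [y, y + h]\<close>: a monomial separates the
  two integrations, so the mean of \<open>X\<^sup>i Y\<^sup>j\<close> is the product of the means of its factors.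
\<close>

definition cell_mean :: "real \<Rightarrow> real poly poly \<Rightarrow> real poly poly" where
  "cell_mean h P = (\<Sum>(i, j)\<in>support2 P.
     smult [:coeff (coeff P i) j:] (tensor (mean_monomial h i) (mean_monomial h j)))"

lemma coeff_cell_mean:
  "coeff (coeff (cell_mean h P) a) b =
     (\<Sum>(i, j)\<in>support2 P. coeff (coeff P i) j *
        (coeff (mean_monomial h i) a * coeff (mean_monomial h j) b))"
  by (simp add: cell_mean_def coeff_sum coeff_tensor case_prod_unfold)

lemma poly2_cell_mean:
  "poly2 (cell_mean h P) (x, y) =
     (\<Sum>(i, j)\<in>support2 P. coeff (coeff P i) j *
        (poly (mean_monomial h i) x * poly (mean_monomial h j) y))"
proof -
  have "poly2 (cell_mean h P) (x, y) = (\<Sum>(i, j)\<in>support2 P. coeff (coeff P i) j *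
      poly2 (tensor (mean_monomial h i) (mean_monomial h j)) (x, y))"
    by (simp add: cell_mean_def poly2_def poly_sum case_prod_unfold)
  then show ?thesis
    by (simp add: poly2_tensor)
qed

text \<open>
  Averaging only produces monomials dividing the original one, so a monomial \<open>X\<^sup>a Y\<^sup>b\<close> of top
  degree can only come from itself, and it does so with factor \<open>1\<close>.
\<close>

lemma top_coeff_cell_mean:
  assumes "h \<noteq> 0" and "(a, b) \<in> support2 P" and "a + b = total_degree P"
  shows "coeff (coeff (cell_mean h P) a) b = coeff (coeff P a) b"
proof -
  have "coeff (coeff (cell_mean h P) a) b =
      (\<Sum>(i, j)\<in>{(a, b)}. coeff (coeff P i) j *
         (coeff (mean_monomial h i) a * coeff (mean_monomial h j) b))"
    unfolding coeff_cell_mean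
  proof (rule sum.mono_neutral_right)
    have vanish: "coeff (mean_monomial h i) a * coeff (mean_monomial h j) b = 0"
      if ij: "(i, j) \<in> support2 P" "(i, j) \<noteq> (a, b)" for i j
    proof -
      have "i + j \<le> a + b"
        using total_degree_ge[OF ij(1)] assms(3) by simp
      with ij(2) have "i < a \<or> j < b"
        by auto
      then show ?thesis
        by (auto simp: coeff_mean_monomial_eq_0)
    qed
    show "\<forall>ij\<in>support2 P - {(a, b)}. (case ij of (i, j) \<Rightarrow> coeff (coeff P i) j *
        (coeff (mean_monomial h i) a * coeff (mean_monomial h j) b)) = 0"
    proof
      fix ij
      assume "ij \<in> support2 P - {(a, b)}"
      with vanish[of "fst ij" "snd ij"] show "(case ij of (i, j) \<Rightarrow> coeff (coeff P i) j *
          (coeff (mean_monomial h i) a * coeff (mean_monomial h j) b)) = 0"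
        by (cases ij) simp
    qed
  qed (use assms in auto)
  then show ?thesis
    using assms(1) by (simp add: coeff_mean_monomial_top)
qed

lemma cell_mean_eq_0_iff:
  assumes "h \<noteq> 0"
  shows "cell_mean h P = 0 \<longleftrightarrow> P = 0"
proof
  assume *: "cell_mean h P = 0"
  show "P = 0"
  proof (rule ccontr)
    assume "P \<noteq> 0"
    then obtain a b where "(a, b) \<in> support2 P" "a + b = total_degree P"
      by (rule total_degree_attained)
    with * top_coeff_cell_mean[OF assms this] show False
      by (simp add: support2_def)
  qed
next
  assume "P = 0"
  then have "support2 P = {}"
    by (simp add: support2_eq_empty_iff)
  then show "cell_mean h P = 0"
    by (simp add: cell_mean_def)
qed

lemma total_degree_cell_mean:
  assumes "h \<noteq> 0"
  shows "total_degree (cell_mean h P) = total_degree P"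
proof (cases "P = 0")
  case True
  moreover from this have "cell_mean h P = 0"
    using cell_mean_eq_0_iff[OF assms] by blast
  ultimately show ?thesis
    by simp
next
  case False
  show ?thesis
  proof (rule antisym)
    have "a + b \<le> total_degree P" if "(a, b) \<in> support2 (cell_mean h P)" for a b
    proof -
      have "coeff (coeff (cell_mean h P) a) b \<noteq> 0"
        using that by (simp add: support2_def)
      then obtain ij where "ij \<in> support2 P" "(case ij of (i, j) \<Rightarrow> coeff (coeff P i) j *
          (coeff (mean_monomial h i) a * coeff (mean_monomial h j) b)) \<noteq> 0"
        unfolding coeff_cell_mean by (rule sum.not_neutral_contains_not_neutral)
      then obtain i j where ij: "(i, j) \<in> support2 P"
        "coeff (mean_monomial h i) a \<noteq> 0" "coeff (mean_monomial h j) b \<noteq> 0"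
        by (cases ij) auto
      then have "a \<le> i" "b \<le> j"
        using coeff_mean_monomial_eq_0 by (meson not_le)+
      with total_degree_ge[OF ij(1)] show ?thesis
        by simp
    qed
    then show "total_degree (cell_mean h P) \<le> total_degree P"
      by (auto simp: total_degree_le_iff)
    obtain a b where ab: "(a, b) \<in> support2 P" "a + b = total_degree P"
      using False by (rule total_degree_attained)
    then have "(a, b) \<in> support2 (cell_mean h P)"
      using top_coeff_cell_mean[OF assms ab] by (simp add: support2_def)
    with total_degree_ge[OF this] ab(2) show "total_degree P \<le> total_degree (cell_mean h P)"
      by simp
  qed
qed

section \<open>The Kantorovich weights of a polynomial\<close>

text \<open>
  The factor \<open>w\<^sup>2\<close> in the series is the reciprocal of the area of a cell, so the bracket is the mean
  of \<open>P\<close> over the cell with lower left corner \<open>(k/w, j/w)\<close>.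
\<close>

lemma kantorovich_term_poly2:
  assumes "w > 0"
  shows "kantorovich_term chi w (poly2 P) x y k j =
    chi (w * x - of_int k, w * y - of_int j) *
      poly2 (cell_mean (1 / w) P) (of_int k / w, of_int j / w)"
proof -
  define h where "h = 1 / w"
  have h: "h > 0" "w * h = 1"
    using assms by (simp_all add: h_def)
  define s t where "s = of_int k / w" and "t = of_int j / w"
  have ends: "(of_int k + 1) / w = s + h" "(of_int j + 1) / w = t + h"
    by (simp_all add: s_def t_def h_def add_divide_distrib)
  have inner: "(LBINT v:{t..t + h}. poly2 P (u, v)) =
      (\<Sum>ij\<in>support2 P. (coeff (coeff P (fst ij)) (snd ij) *
         (h * poly (mean_monomial h (snd ij)) t)) * u ^ fst ij)" for u
  proof -
    have "(LBINT v:{t..t + h}. poly2 P (u, v)) = (LBINT v:{t..t + h}.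
        (\<Sum>ij\<in>support2 P. (coeff (coeff P (fst ij)) (snd ij) * u ^ fst ij) * v ^ snd ij))"
      by (simp add: poly2_support case_prod_unfold)
    also have "\<dots> = (\<Sum>ij\<in>support2 P. (coeff (coeff P (fst ij)) (snd ij) * u ^ fst ij) *
        (LBINT v:{t..t + h}. v ^ snd ij))"
      by (rule set_integral_finite_combination) (intro continuous_intros)
    finally show ?thesis
      by (simp add: set_integral_power_eq_mean_monomial[OF h(1)] mult_ac)
  qed
  have "(LBINT u:{s..s + h}. LBINT v:{t..t + h}. poly2 P (u, v)) =
      (\<Sum>ij\<in>support2 P. (coeff (coeff P (fst ij)) (snd ij) *
         (h * poly (mean_monomial h (snd ij)) t)) * (LBINT u:{s..s + h}. u ^ fst ij))"
    unfolding inner by (rule set_integral_finite_combination) (intro continuous_intros)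
  also have "\<dots> = h\<^sup>2 * poly2 (cell_mean h P) (s, t)"
    by (simp add: set_integral_power_eq_mean_monomial[OF h(1)] poly2_cell_mean case_prod_unfold
        sum_distrib_left power2_eq_square mult_ac)
  finally have "w\<^sup>2 * (LBINT u:{s..s + h}. LBINT v:{t..t + h}. poly2 P (u, v)) =
      (w * h)\<^sup>2 * poly2 (cell_mean h P) (s, t)"
    by (simp add: power_mult_distrib)
  then show ?thesis
    unfolding kantorovich_term_def ends s_def[symmetric] t_def[symmetric] h_def[symmetric]
    by (simp add: h(2))
qed

section \<open>Reproduction of polynomials by the sampling series\<close>

text \<open>
  The moment of order \<open>0\<close> is governed by the partition of unity property of the kernel, the others
  by the moment condition.
\<close>

lemma moments_below_order:
  assumes "sampling_kernel chi" and "moment_condition r c chi" and "m + n < r"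
  shows "has_double_sum (moment_term chi m n u v) (if m = 0 \<and> n = 0 then 1 else 0)"
proof (cases "m = 0 \<and> n = 0")
  case True
  then have "moment_term chi m n u v = (\<lambda>k j. chi (u - of_int k, v - of_int j))"
    by (simp add: moment_term_def fun_eq_iff)
  with True assms(1) show ?thesis
    by (simp add: has_double_sum_iff sampling_kernel_def)
next
  case False
  with assms(3) have "m + n \<in> {1..r}" "m + n \<in> {1..<r}"
    by auto
  with False assms(2) show ?thesis
    unfolding has_double_sum_iff moment_condition_def moment_def by (simp only: if_False)
qed

text \<open>
  Since \<open>k/w = x - (wx - k)/w\<close>, a polynomial in \<open>k/w\<close> is a polynomial in the argument \<open>wx - k\<close> of
  the kernel, of the same degree and with constant term \<open>p(x)\<close>. So only this constant term
  survives the vanishing of the moments.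
\<close>

lemma sampling_series_reproduces_polynomials:
  assumes "sampling_kernel chi" and "moment_condition r c chi" and "w \<noteq> 0"
    and "degree p + degree q < r"
  shows "has_double_sum (\<lambda>k j. chi (w * x - of_int k, w * y - of_int j) *
      (poly p (of_int k / w) * poly q (of_int j / w))) (poly p x * poly q y)"
proof -
  define p' q' where "p' = pcompose p [:x, -1 / w:]" and "q' = pcompose q [:y, -1 / w:]"
  have deg: "degree p' = degree p" "degree q' = degree q"
    using assms(3) by (simp_all add: p'_def q'_def degree_pcompose)
  have expand: "poly p (of_int k / w) = poly p' (w * x - of_int k)"
    "poly q (of_int k / w) = poly q' (w * y - of_int k)" for k
    using assms(3) by (simp_all add: p'_def q'_def poly_pcompose field_simps)
  let ?I = "{..degree p} \<times> {..degree q}"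
  have "has_double_sum
      (\<lambda>k j. \<Sum>mn\<in>?I. (coeff p' (fst mn) * coeff q' (snd mn)) *
         moment_term chi (fst mn) (snd mn) (w * x) (w * y) k j)
      (\<Sum>mn\<in>?I. (coeff p' (fst mn) * coeff q' (snd mn)) *
         (if fst mn = 0 \<and> snd mn = 0 then 1 else 0))"
    using assms(4)
    by (intro has_double_sum_sum has_double_sum_cmult moments_below_order[OF assms(1,2)]) auto
  moreover have "(\<Sum>mn\<in>?I. (coeff p' (fst mn) * coeff q' (snd mn)) *
      moment_term chi (fst mn) (snd mn) (w * x) (w * y) k j) =
      chi (w * x - of_int k, w * y - of_int j) *
        (poly p (of_int k / w) * poly q (of_int j / w))" for k j
    unfolding expand poly_altdef[of p'] poly_altdef[of q'] deg sum_product sum.cartesian_product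
    by (simp add: sum_distrib_left case_prod_unfold moment_term_def mult_ac)
  moreover have "(\<Sum>mn\<in>?I. (coeff p' (fst mn) * coeff q' (snd mn)) *
      (if fst mn = 0 \<and> snd mn = 0 then 1 else 0)) = poly p x * poly q y"
  proof -
    have "(\<Sum>mn\<in>?I. (coeff p' (fst mn) * coeff q' (snd mn)) *
        (if fst mn = 0 \<and> snd mn = 0 then 1 else 0)) =
        (\<Sum>mn\<in>{(0, 0)}. coeff p' (fst mn) * coeff q' (snd mn))"
      by (rule sum.mono_neutral_cong_right) auto
    then show ?thesis
      by (simp add: p'_def q'_def)
  qed
  ultimately show ?thesis
    by simp
qed

section \<open>The Kantorovich operator on polynomials\<close>

theorem theorem5:
  fixes chi :: "real \<times> real \<Rightarrow> real" and r :: nat and c w :: real and P :: "real poly poly"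
  assumes "r \<ge> 1"
    and "sampling_kernel chi"
    and "moment_condition r c chi"
    and "w > 0"
    and "total_degree P \<le> r - 1"
  shows "(\<forall>x y. double_summable (kantorovich_term chi w (poly2 P) x y)) \<and>
         (\<exists>Q. kantorovich chi w (poly2 P) = poly2 Q \<and>
              total_degree Q = total_degree P \<and> (Q = 0 \<longleftrightarrow> P = 0))"
proof -
  define h where "h = 1 / w"
  have h: "h \<noteq> 0"
    using assms(4) by (simp add: h_def)
  have series: "has_double_sum (kantorovich_term chi w (poly2 P) x y)
      (poly2 (cell_mean h P) (x, y))" for x y
  proof -
    have "has_double_sum
        (\<lambda>k j. \<Sum>ab\<in>support2 P. coeff (coeff P (fst ab)) (snd ab) *
           (chi (w * x - of_int k, w * y - of_int j) *
             (poly (mean_monomial h (fst ab)) (of_int k / w) *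
              poly (mean_monomial h (snd ab)) (of_int j / w))))
        (\<Sum>ab\<in>support2 P. coeff (coeff P (fst ab)) (snd ab) *
           (poly (mean_monomial h (fst ab)) x * poly (mean_monomial h (snd ab)) y))"
    proof (intro has_double_sum_sum has_double_sum_cmult
        sampling_series_reproduces_polynomials[OF assms(2,3)])
      fix ab
      assume "ab \<in> support2 P"
      then have "fst ab + snd ab < r"
        using total_degree_ge[of "fst ab" "snd ab" P] assms(1,5) by simp
      then show "degree (mean_monomial h (fst ab)) + degree (mean_monomial h (snd ab)) < r"
        using degree_mean_monomial_le[of h "fst ab"] degree_mean_monomial_le[of h "snd ab"]
        by linarith
    qed (use assms(4) in simp)
    moreover have "kantorovich_term chi w (poly2 P) x y = (\<lambda>k j. \<Sum>ab\<in>support2 P.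
        coeff (coeff P (fst ab)) (snd ab) * (chi (w * x - of_int k, w * y - of_int j) *
          (poly (mean_monomial h (fst ab)) (of_int k / w) *
           poly (mean_monomial h (snd ab)) (of_int j / w))))"
      by (simp add: fun_eq_iff kantorovich_term_poly2[OF assms(4)] h_def[symmetric]
          poly2_cell_mean case_prod_unfold sum_distrib_left mult_ac)
    ultimately show ?thesis
      by (simp add: poly2_cell_mean case_prod_unfold)
  qed
  have "kantorovich chi w (poly2 P) = poly2 (cell_mean h P)"
    using series by (auto simp: kantorovich_def has_double_sum_iff)
  moreover have "\<forall>x y. double_summable (kantorovich_term chi w (poly2 P) x y)"
    using series by (auto simp: has_double_sum_iff)
  ultimately show ?thesis
    using total_degree_cell_mean[OF h, of P] cell_mean_eq_0_iff[OF h, of P] by blast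
qed

end
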